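(* Let $K=\mathbb{F}_q$ be a finite field with $q$ elements, let $s\ge 1$, let $T=(K^* )^s\subset\mathbb{A}^s=K^s$ be the affine torus, and let $d\ge 0$ be an integer. The length of $C_T(d)$ is $(q-1)^s$ and its dimension is $$ \dim_K C_T(d)=\sum_{j=0}^{\left\lfloor\frac{d}{q-1}\right\rfloor}(-1)^j\binom{s}{j}\binom{s+d-j(q-1)}{s}. $$
   Context: $K^*=K\setminus\{0\}$. Let $S=K[t_1,\ldots,t_s]$, let $S_{\le d}$ be the space of polynomials in $S$ of degree at most $d$, and let $P_1,\ldots,P_m$ be the points of $T$. The code $C_T(d)\subset K^m$ is the image of the linear map $S_{\le d}\to K^m$, $f\mapsto(f(P_1),\ldots,f(P_m))$. Its length is $m=|T|$ and its dimension is its dimension as a $K$-vector space. *)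

theory Defs
  imports "HOL-Analysis.Cartesian_Space" "HOL-Library.Poly_Mapping"
begin

text \<open>Multivariate polynomials over \<^typ>\<open>'a\<close> with variables indexed by \<^typ>\<open>'n\<close>: finitely supported
  functions from exponent vectors to coefficients.\<close>

type_synonym ('n, 'a) mpoly = "('n \<Rightarrow>\<^sub>0 nat) \<Rightarrow>\<^sub>0 'a"

definition mpoly_eval :: "('n::finite, 'a::comm_semiring_1) mpoly \<Rightarrow> 'a ^ 'n \<Rightarrow> 'a" where
  "mpoly_eval f x =
     (\<Sum>e\<in>Poly_Mapping.keys f. Poly_Mapping.lookup f e * (\<Prod>i\<in>UNIV. x $ i ^ Poly_Mapping.lookup e i))"

text \<open>As for univariate polynomials in the library, the zero polynomial gets degree \<open>0\<close>, so that it
  belongs to \<open>mpolys_le d\<close> for every \<open>d\<close>.\<close>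

definition total_degree :: "('n::finite, 'a::zero) mpoly \<Rightarrow> nat" where
  "total_degree f = Max (insert 0 ((\<lambda>e. \<Sum>i\<in>UNIV. Poly_Mapping.lookup e i) ` Poly_Mapping.keys f))"

definition mpolys_le :: "nat \<Rightarrow> ('n::finite, 'a::zero) mpoly set" where
  "mpolys_le d = {f. total_degree f \<le> d}"

definition affine_torus :: "('a::zero ^ 'n) set" where
  "affine_torus = {x. \<forall>i. x $ i \<noteq> 0}"

text \<open>The points are given as a family \<open>P\<close> indexed by a finite type \<^typ>\<open>'m\<close>, so that the ambient
  space \<open>K\<^sup>m\<close> is \<^typ>\<open>'a ^ 'm\<close> with \<open>m = CARD('m)\<close>.\<close>

definition evaluation_code :: "('m::finite \<Rightarrow> 'a::field ^ 'n::finite) \<Rightarrow> nat \<Rightarrow> ('a ^ 'm) set" where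
  "evaluation_code P d = (\<lambda>f. \<chi> k. mpoly_eval f (P k)) ` mpolys_le d"

definition code_length :: "('a ^ 'm::finite) set \<Rightarrow> nat" where
  "code_length C = CARD('m)"

end

theory Submission
  imports Defs "HOL-Computational_Algebra.Formal_Power_Series" "HOL-Computational_Algebra.Polynomial"
begin

text \<open>
  Let \<open>r = q - 1\<close>. As \<open>x ^ r = 1\<close> on \<open>K\<^sup>*\<close>, exponents can be reduced modulo \<open>r\<close>, so the code is spanned
  by the values of the monomials of degree at most \<open>d\<close> with all exponents below \<open>r\<close>. These vectors
  are linearly independent: \<open>\<Sum>x\<in>K\<^sup>*. x ^ k\<close> is \<open>-1\<close> or \<open>0\<close> according to whether \<open>r\<close> divides \<open>k\<close>, hence
  the monomials with exponents \<open>r - e i\<close> form a dual family up to sign. The number of reduced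
  exponents of degree at most \<open>d\<close> is the coefficient of \<open>X ^ d\<close> in
  \<open>(1 + X + \<dots> + X ^ (r - 1)) ^ s / (1 - X) = (1 - X ^ r) ^ s / (1 - X) ^ (s + 1)\<close>.
\<close>

section \<open>Power sums over a finite field\<close>

lemma card_field_gt_1: "CARD('a::{field,finite}) > 1"
proof -
  have "card {0, 1::'a} \<le> CARD('a)"
    by (rule card_mono) auto
  then show ?thesis by simp
qed

lemma card_nonzero: "card {x::'a::{field,finite}. x \<noteq> 0} = CARD('a) - 1"
proof -
  have "{x::'a. x \<noteq> 0} = UNIV - {0}" by auto
  then show ?thesis by (simp add: card_Diff_singleton)
qed

text \<open>Adding 1 permutes the ring, so the sum of all elements equals itself plus
  \<open>CARD('a)\<close> ones; cancel.\<close>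

lemma of_nat_card_eq_0: "of_nat CARD('a) = (0::'a::{ring_1,finite})"
proof -
  have "(\<Sum>x\<in>(UNIV::'a set). x) = (\<Sum>x\<in>UNIV. x + 1)"
    by (rule sum.reindex_bij_witness[of _ "\<lambda>x. x + 1" "\<lambda>x. x - 1"]) auto
  also have "\<dots> = (\<Sum>x\<in>UNIV. x) + of_nat CARD('a)"
    by (simp add: sum.distrib)
  finally show ?thesis by simp
qed

text \<open>Multiplication by \<open>x\<close> permutes the nonzero elements, so their product is
  unchanged by the factor \<open>x ^ (CARD('a) - 1)\<close>; being nonzero, it cancels.\<close>

lemma nonzero_power_card:
  fixes x :: "'a::{field,finite}"
  assumes "x \<noteq> 0"
  shows "x ^ (CARD('a) - 1) = 1"
proof -
  let ?U = "{y::'a. y \<noteq> 0}"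
  have "(\<Prod>y\<in>?U. y) = (\<Prod>y\<in>?U. x * y)"
    by (rule prod.reindex_bij_witness[of _ "\<lambda>y. x * y" "\<lambda>y. y / x"]) (use assms in auto)
  also have "\<dots> = x ^ (CARD('a) - 1) * (\<Prod>y\<in>?U. y)"
    by (simp add: prod.distrib card_nonzero)
  finally show ?thesis by simp
qed

lemma nonzero_power_mod:
  fixes x :: "'a::{field,finite}"
  assumes "x \<noteq> 0"
  shows "x ^ (k mod (CARD('a) - 1)) = x ^ k"
proof -
  let ?r = "CARD('a) - 1"
  have "x ^ k = x ^ (?r * (k div ?r) + k mod ?r)" by simp
  also have "\<dots> = x ^ (k mod ?r)"
    using nonzero_power_card[OF assms] by (simp only: power_add power_mult) simp
  finally show ?thesis by simp
qed

text \<open>If \<open>CARD('a) - 1\<close> divides \<open>k\<close>, every summand is 1, and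
  \<open>CARD('a)\<close> vanishes in the field. Otherwise some nonzero \<open>y\<close> has
  \<open>y ^ k\<close> different from 1; the substitution of \<open>y * x\<close> for
  \<open>x\<close> multiplies the sum by \<open>y ^ k\<close>, so it must vanish.\<close>

lemma sum_power_nonzero:
  "(\<Sum>x | x \<noteq> 0. x ^ k) = (if (CARD('a) - 1) dvd k then - 1 else (0::'a::{field,finite}))"
proof (cases "(CARD('a) - 1) dvd k")
  case True
  have "(x::'a) ^ k = 1" if "x \<noteq> 0" for x
    using nonzero_power_mod[OF that, of k] True by simp
  then have "(\<Sum>x | x \<noteq> 0. x ^ k) = (of_nat (CARD('a) - 1) :: 'a)"
    by (simp add: card_nonzero)
  also have "\<dots> = - 1"
    using card_field_gt_1[where 'a='a] by (simp add: of_nat_diff of_nat_card_eq_0)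
  finally show ?thesis using True by simp
next
  case False
  let ?l = "k mod (CARD('a) - 1)"
  let ?p = "monom 1 ?l - 1 :: 'a poly"
  have l: "0 < ?l" "?l < CARD('a) - 1"
    using False card_field_gt_1[where 'a='a] by (auto simp: mod_greater_zero_iff_not_dvd)
  have coeff: "coeff ?p ?l = 1"
    using l(1) by (simp add: coeff_1)
  then have nz: "?p \<noteq> 0" by (metis coeff_0 zero_neq_one)
  have "degree ?p \<le> ?l"
    by (rule degree_diff_le) (simp_all add: degree_monom_le)
  \<comment> \<open>Otherwise \<open>?p\<close> would have \<open>CARD('a) - 1\<close> roots, more
    than its degree permits.\<close>
  have "\<exists>y. y \<noteq> 0 \<and> y ^ ?l \<noteq> (1::'a)"
  proof (rule ccontr)
    assume "\<not> ?thesis"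
    then have "{y. y \<noteq> 0} \<subseteq> {y. poly ?p y = 0}"
      by (auto simp: poly_monom)
    then have "card {y::'a. y \<noteq> 0} \<le> card {y. poly ?p y = 0}"
      by (intro card_mono) auto
    also have "\<dots> \<le> degree ?p"
      by (rule card_poly_roots_bound[OF nz])
    finally show False
      using l \<open>degree ?p \<le> ?l\<close> by (simp add: card_nonzero)
  qed
  then obtain y :: 'a where y: "y \<noteq> 0" "y ^ k \<noteq> 1"
    using nonzero_power_mod by metis
  have "(\<Sum>x | x \<noteq> 0. x ^ k) = (\<Sum>x | x \<noteq> 0. (y * x) ^ k)"
    by (rule sum.reindex_bij_witness[of _ "\<lambda>x. y * x" "\<lambda>x. x / y"]) (use y(1) in auto)
  also have "\<dots> = y ^ k * (\<Sum>x | x \<noteq> 0. x ^ k)"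
    by (simp add: power_mult_distrib sum_distrib_left)
  finally show ?thesis using y(2) False by simp
qed

section \<open>Monomials on the torus\<close>

definition monomial_value :: "('n::finite \<Rightarrow> nat) \<Rightarrow> 'a::comm_semiring_1 ^ 'n \<Rightarrow> 'a" where
  "monomial_value e x = (\<Prod>i\<in>UNIV. x $ i ^ e i)"

lemma bij_betw_vec_lambda_torus:
  "bij_betw vec_lambda (PiE UNIV (\<lambda>_. {x. x \<noteq> 0})) (affine_torus :: ('a::zero ^ 'n::finite) set)"
  by (rule bij_betw_byWitness[where f' = "($)"]) (auto simp: affine_torus_def)

lemma card_affine_torus:
  "card (affine_torus :: ('a::{field,finite} ^ 'n::finite) set) = (CARD('a) - 1) ^ CARD('n)"
  using bij_betw_same_card[OF bij_betw_vec_lambda_torus[where 'a='a and 'n='n]]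
  by (simp add: card_PiE card_nonzero)

text \<open>The torus is a product set, so expanding the product of sums yields one term for each of
  its points.\<close>

lemma sum_monomial_value_torus:
  fixes e :: "'n::finite \<Rightarrow> nat"
  shows "(\<Sum>x\<in>affine_torus. monomial_value e x) =
    (\<Prod>i\<in>UNIV. \<Sum>x | x \<noteq> (0::'a::{field,finite}). x ^ e i)"
proof -
  have "(\<Prod>i\<in>UNIV. \<Sum>x | x \<noteq> (0::'a). x ^ e i) =
      (\<Sum>f\<in>PiE UNIV (\<lambda>_. {x. x \<noteq> 0}). \<Prod>i\<in>UNIV. f i ^ e i)"
    by (rule prod_sum_PiE) auto
  also have "\<dots> = (\<Sum>f\<in>PiE UNIV (\<lambda>_. {x. x \<noteq> (0::'a)}). monomial_value e (vec_lambda f))"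
    by (simp add: monomial_value_def)
  also have "\<dots> = (\<Sum>x\<in>affine_torus. monomial_value e x)"
    by (rule sum.reindex_bij_betw[OF bij_betw_vec_lambda_torus])
  finally show ?thesis by simp
qed

text \<open>For \<open>r = CARD('a) - 1\<close> these are the exponents that remain after reduction
  by \<open>x ^ r = 1\<close>; they index the basis of the code.\<close>

definition reduced_exponents :: "nat \<Rightarrow> nat \<Rightarrow> ('n::finite \<Rightarrow> nat) set" where
  "reduced_exponents r d = {e. (\<forall>i. e i < r) \<and> sum e UNIV \<le> d}"

lemma finite_reduced_exponents: "finite (reduced_exponents r d)"
proof (rule finite_subset)
  show "reduced_exponents r d \<subseteq> PiE UNIV (\<lambda>_. {..<r})"
    by (auto simp: reduced_exponents_def)
qed (auto intro: finite_PiE)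

text \<open>On the torus, \<open>?r - e' i\<close> acts as the exponent \<open>- e' i\<close> while
  staying a natural number. The sum factors over the coordinates, and one differing coordinate makes
  it vanish.\<close>

lemma sum_monomial_value_dual:
  fixes e e' :: "'n::finite \<Rightarrow> nat"
  assumes "\<forall>i. e i < CARD('a::{field,finite}) - 1" "\<forall>i. e' i < CARD('a) - 1"
  shows "(\<Sum>x\<in>affine_torus. monomial_value e x *
            monomial_value (\<lambda>i. CARD('a) - 1 - e' i) x) =
         (if e = e' then (- 1) ^ CARD('n) else (0::'a))"
proof -
  let ?r = "CARD('a) - 1"
  have dvd: "?r dvd e i + (?r - e' i) \<longleftrightarrow> e i = e' i" for i
  proof
    assume "?r dvd e i + (?r - e' i)"
    then obtain c where c: "e i + (?r - e' i) = ?r * c" ..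
    \<comment> \<open>Both exponents lie below \<open>?r\<close>, which leaves \<open>?r\<close>
      itself as the only possible multiple.\<close>
    have "0 < ?r * c" "?r * c < ?r * 2"
      unfolding c[symmetric] using assms(1)[rule_format, of i] assms(2)[rule_format, of i] by linarith+
    then have "c = 1" by auto
    then show "e i = e' i" using c assms(2)[rule_format, of i] by simp
  next
    assume "e i = e' i"
    then show "?r dvd e i + (?r - e' i)" using assms(2)[rule_format, of i] by simp
  qed
  have "(\<Sum>x\<in>affine_torus. monomial_value e x * monomial_value (\<lambda>i. ?r - e' i) x) =
      (\<Sum>x\<in>affine_torus. monomial_value (\<lambda>i. e i + (?r - e' i)) (x :: 'a ^ 'n))"
    by (simp add: monomial_value_def power_add prod.distrib)
  also have "\<dots> = (\<Prod>i\<in>UNIV. if e i = e' i then - 1 else 0)"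
    by (simp only: sum_monomial_value_torus sum_power_nonzero dvd)
  also have "\<dots> = (if e = e' then (- 1) ^ CARD('n) else 0)"
    by (auto simp: fun_eq_iff)
  finally show ?thesis .
qed

section \<open>A monomial basis of the code\<close>

text \<open>Allows polynomials with different supports to be evaluated over a common index set; the
  added terms have coefficient 0.\<close>

lemma mpoly_eval_superset:
  assumes "finite S" "Poly_Mapping.keys f \<subseteq> S"
  shows "mpoly_eval f x =
    (\<Sum>e\<in>S. Poly_Mapping.lookup f e * monomial_value (Poly_Mapping.lookup e) x)"
  unfolding mpoly_eval_def monomial_value_def
  by (rule sum.mono_neutral_left[OF assms]) (auto simp: in_keys_iff)

lemma mpoly_eval_add: "mpoly_eval (f + g) x = mpoly_eval f x + mpoly_eval g x"
proof -
  let ?S = "Poly_Mapping.keys f \<union> Poly_Mapping.keys g"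
  have "Poly_Mapping.keys (f + g) \<subseteq> ?S" by (rule Poly_Mapping.keys_add)
  then show ?thesis
    by (simp add: mpoly_eval_superset[of ?S] lookup_add sum.distrib distrib_right)
qed

lemma mpoly_eval_sum: "mpoly_eval (sum f A) x = (\<Sum>a\<in>A. mpoly_eval (f a) x)"
  by (induction A rule: infinite_finite_induct) (simp_all add: mpoly_eval_add, simp_all add: mpoly_eval_def)

lemma mpoly_eval_single:
  "mpoly_eval (Poly_Mapping.single e c) x = c * monomial_value (Poly_Mapping.lookup e) x"
  by (simp add: mpoly_eval_superset[of "{e}"])

lemma mpolys_le_iff:
  "f \<in> mpolys_le d \<longleftrightarrow> (\<forall>e\<in>Poly_Mapping.keys f. sum (Poly_Mapping.lookup e) UNIV \<le> d)"
  by (auto simp: mpolys_le_def total_degree_def)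

definition monomial_codeword :: "('m::finite \<Rightarrow> 'a::comm_semiring_1 ^ 'n::finite) \<Rightarrow> ('n \<Rightarrow> nat) \<Rightarrow> 'a ^ 'm" where
  "monomial_codeword P e = (\<chi> k. monomial_value e (P k))"

context
  fixes P :: "'m::finite \<Rightarrow> 'a::{field,finite} ^ 'n::finite"
  assumes bij: "bij_betw P UNIV affine_torus"
begin

lemma sum_monomial_codeword_dual:
  fixes e e' :: "'n \<Rightarrow> nat"
  assumes "\<forall>i. e i < CARD('a) - 1" "\<forall>i. e' i < CARD('a) - 1"
  shows "(\<Sum>k\<in>UNIV. monomial_codeword P e $ k *
      monomial_value (\<lambda>i. CARD('a) - 1 - e' i) (P k)) = (if e = e' then (- 1) ^ CARD('n) else 0)"
  unfolding sum_monomial_value_dual[OF assms, symmetric] monomial_codeword_def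
  by (simp add: sum.reindex_bij_betw[OF bij, symmetric])

text \<open>Equal codewords have equal pairings with the dual vector of \<open>e'\<close>, but
  distinct exponents would give 0 and a sign. Injectivity lets sums over the set of codewords be
  indexed by exponents.\<close>

lemma inj_on_monomial_codeword:
  "inj_on (monomial_codeword P) (reduced_exponents (CARD('a) - 1) d)"
proof (rule inj_onI, rule ccontr)
  fix e e' :: "'n \<Rightarrow> nat"
  assume e: "e \<in> reduced_exponents (CARD('a) - 1) d" and e': "e' \<in> reduced_exponents (CARD('a) - 1) d"
    and eq: "monomial_codeword P e = monomial_codeword P e'" and ne: "e \<noteq> e'"
  show False
    using sum_monomial_codeword_dual[of e e'] sum_monomial_codeword_dual[of e' e'] e e' eq ne
    by (simp add: reduced_exponents_def)
qed

lemma independent_monomial_codewords: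
  "vec.independent (monomial_codeword P ` reduced_exponents (CARD('a) - 1) d)"
    (is "vec.independent (_ ` ?E)")
proof (rule vec.independent_if_scalars_zero)
  show "finite (monomial_codeword P ` ?E)"
    by (simp add: finite_reduced_exponents)
next
  fix u v
  assume sum0: "(\<Sum>w\<in>monomial_codeword P ` ?E. u w *s w) = 0" and "v \<in> monomial_codeword P ` ?E"
  then obtain e' where e': "e' \<in> ?E" and v: "v = monomial_codeword P e'" by blast
  let ?c = "\<lambda>k. monomial_value (\<lambda>i. CARD('a) - 1 - e' i) (P k)"
  have "(\<Sum>e\<in>?E. u (monomial_codeword P e) *s monomial_codeword P e) = 0"
    using sum0 by (simp add: sum.reindex[OF inj_on_monomial_codeword] del: One_nat_def)
  then have "(\<Sum>e\<in>?E. u (monomial_codeword P e) *s monomial_codeword P e) $ k = 0" for k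
    by simp
  \<comment> \<open>Pairing the vanishing combination with the dual vector of \<open>e'\<close>
    isolates the coefficient of \<open>v\<close>, up to sign.\<close>
  then have "0 = (\<Sum>k\<in>UNIV. (\<Sum>e\<in>?E. u (monomial_codeword P e) * monomial_codeword P e $ k) * ?c k)"
    by simp
  also have "\<dots> = (\<Sum>e\<in>?E. u (monomial_codeword P e) * (\<Sum>k\<in>UNIV. monomial_codeword P e $ k * ?c k))"
    unfolding sum_distrib_right sum_distrib_left by (subst sum.swap) (simp add: mult.assoc)
  also have "\<dots> = (\<Sum>e\<in>?E. if e = e' then u v * (- 1) ^ CARD('n) else 0)"
    using e' by (intro sum.cong refl) (simp add: sum_monomial_codeword_dual reduced_exponents_def v del: One_nat_def diff_diff_left)
  also have "\<dots> = u v * (- 1) ^ CARD('n)"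
    using e' by (simp add: finite_reduced_exponents)
  finally show "u v = 0" by simp
qed

lemma monomial_codeword_mod:
  "monomial_codeword P (\<lambda>i. e i mod (CARD('a) - 1)) = monomial_codeword P e"
proof -
  have "P k $ i \<noteq> 0" for k i
    using bij_betwE[OF bij] by (auto simp: affine_torus_def)
  then show ?thesis
    by (simp add: monomial_codeword_def monomial_value_def nonzero_power_mod del: One_nat_def)
qed

lemma evaluation_code_eq_span:
  "evaluation_code P d = vec.span (monomial_codeword P ` reduced_exponents (CARD('a) - 1) d)"
    (is "_ = vec.span (_ ` ?E)")
proof (intro equalityI subsetI)
  fix w assume "w \<in> evaluation_code P d"
  then obtain f where f: "f \<in> mpolys_le d" and w: "w = (\<chi> k. mpoly_eval f (P k))"
    by (auto simp: evaluation_code_def)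
  have "w = (\<Sum>e\<in>Poly_Mapping.keys f. Poly_Mapping.lookup f e *s monomial_codeword P (Poly_Mapping.lookup e))"
    by (simp add: w vec_eq_iff mpoly_eval_def monomial_codeword_def monomial_value_def)
  also have "\<dots> \<in> vec.span (monomial_codeword P ` ?E)"
  proof (intro vec.span_sum vec.span_scale vec.span_base)
    fix e assume "e \<in> Poly_Mapping.keys f"
    let ?e = "\<lambda>i. Poly_Mapping.lookup e i mod (CARD('a) - 1)"
    \<comment> \<open>Reduction never raises an exponent, so the degree bound survives.\<close>
    have "sum ?e UNIV \<le> sum (Poly_Mapping.lookup e) UNIV"
      by (rule sum_mono) simp
    also have "\<dots> \<le> d"
      using f \<open>e \<in> _\<close> by (simp add: mpolys_le_iff)
    finally have "?e \<in> ?E"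
      using card_field_gt_1[where 'a='a] by (simp add: reduced_exponents_def)
    then have "monomial_codeword P ?e \<in> monomial_codeword P ` ?E" by (rule imageI)
    then show "monomial_codeword P (Poly_Mapping.lookup e) \<in> monomial_codeword P ` ?E"
      by (simp only: monomial_codeword_mod)
  qed
  finally show "w \<in> vec.span (monomial_codeword P ` ?E)" .
next
  fix w assume "w \<in> vec.span (monomial_codeword P ` ?E)"
  then obtain u where "w = (\<Sum>v\<in>monomial_codeword P ` ?E. u v *s v)"
    by (auto simp: vec.span_finite finite_reduced_exponents)
  then have w: "w = (\<Sum>e\<in>?E. u (monomial_codeword P e) *s monomial_codeword P e)"
    by (simp add: sum.reindex[OF inj_on_monomial_codeword] del: One_nat_def)
  \<comment> \<open>The coefficients of the combination define a polynomial already of degree at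
    most \<open>d\<close>. Each \<open>e\<close> is a valid exponent vector, since its domain is
    finite.\<close>
  let ?f = "\<Sum>e\<in>?E. Poly_Mapping.single (Abs_poly_mapping e) (u (monomial_codeword P e))"
  have lookup: "Poly_Mapping.lookup (Abs_poly_mapping e) = e" for e :: "'n \<Rightarrow> nat"
    by simp
  have "Poly_Mapping.keys ?f \<subseteq> Abs_poly_mapping ` ?E"
    by (rule order_trans[OF keys_sum]) auto
  then have "?f \<in> mpolys_le d"
    by (fastforce simp: mpolys_le_iff lookup reduced_exponents_def)
  moreover have "w = (\<chi> k. mpoly_eval ?f (P k))"
    by (simp add: w vec_eq_iff mpoly_eval_sum mpoly_eval_single lookup monomial_codeword_def)
  ultimately show "w \<in> evaluation_code P d"
    by (auto simp: evaluation_code_def)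
qed

lemma dim_evaluation_code:
  "vec.dim (evaluation_code P d) = card (reduced_exponents (CARD('a) - 1) d :: ('n \<Rightarrow> nat) set)"
  by (simp add: evaluation_code_eq_span vec.dim_span vec.dim_eq_card_independent
      independent_monomial_codewords card_image inj_on_monomial_codeword del: One_nat_def)

end

section \<open>Counting reduced exponents\<close>

text \<open>The expansion of \<open>1 / (1 - X) ^ (s + 1)\<close>, stated over the integers without division.\<close>

lemma one_minus_fps_X_power_mult_binomial_series:
  "(1 - fps_X) ^ s * Abs_fps (\<lambda>n. int ((s + n) choose s)) = Abs_fps (\<lambda>_. 1)"
proof (induction s)
  case (Suc s)
  \<comment> \<open>This is Pascal's rule: differencing in \<open>n\<close> lowers \<open>s\<close>
    by one.\<close>
  have "(1 - fps_X) * Abs_fps (\<lambda>n. int ((Suc s + n) choose Suc s)) = Abs_fps (\<lambda>n. int ((s + n) choose s))"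
  proof (rule fps_ext)
    fix n
    show "fps_nth ((1 - fps_X) * Abs_fps (\<lambda>n. int ((Suc s + n) choose Suc s))) n =
        fps_nth (Abs_fps (\<lambda>n. int ((s + n) choose s))) n"
      by (cases n) (simp_all add: left_diff_distrib)
  qed
  then show ?case
    by (simp only: power_Suc2 mult.assoc Suc)
qed simp

text \<open>The power counts exponents below \<open>r\<close> by exact total degree; multiplication
  by the all-ones series takes partial sums, which turns this into degree at most
  \<open>d\<close>.\<close>

lemma reduced_exponents_generating_function:
  "(\<Sum>t<r. fps_X ^ t) ^ CARD('n) * Abs_fps (\<lambda>_. 1) =
     Abs_fps (\<lambda>d. int (card (reduced_exponents r d :: ('n::finite \<Rightarrow> nat) set)))"
proof (rule fps_ext)
  fix d
  let ?Q = "PiE (UNIV::'n set) (\<lambda>_. {..<r})"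
  have "(\<Sum>t<r. fps_X ^ t :: int fps) ^ CARD('n) = (\<Prod>i\<in>(UNIV::'n set). \<Sum>t<r. fps_X ^ t)"
    by simp
  also have "\<dots> = (\<Sum>e\<in>?Q. \<Prod>i\<in>UNIV. fps_X ^ e i)"
    by (rule prod_sum_PiE) auto
  also have "\<dots> = (\<Sum>e\<in>?Q. fps_X ^ sum e UNIV)"
    by (simp add: power_sum)
  finally have "fps_nth ((\<Sum>t<r. fps_X ^ t) ^ CARD('n) * Abs_fps (\<lambda>_. 1)) d =
      (\<Sum>e\<in>?Q. if d < sum e UNIV then 0 else (1::int))"
    by (simp add: sum_distrib_right fps_sum_nth fps_X_power_mult_nth cong: if_cong)
  also have "\<dots> = (\<Sum>e\<in>(reduced_exponents r d :: ('n \<Rightarrow> nat) set). 1)"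
    by (rule sum.mono_neutral_cong_right) (auto simp: reduced_exponents_def intro: finite_PiE)
  finally show "fps_nth ((\<Sum>t<r. fps_X ^ t) ^ CARD('n) * Abs_fps (\<lambda>_. 1)) d =
      fps_nth (Abs_fps (\<lambda>d. int (card (reduced_exponents r d :: ('n \<Rightarrow> nat) set)))) d"
    by simp
qed

lemma card_reduced_exponents:
  assumes "r > 0"
  shows "int (card (reduced_exponents r d :: ('n::finite \<Rightarrow> nat) set)) =
    (\<Sum>j = 0..d div r. (- 1) ^ j * int (CARD('n) choose j) * int ((CARD('n) + d - j * r) choose CARD('n)))"
proof -
  let ?s = "CARD('n)"
  let ?B = "Abs_fps (\<lambda>n. int ((?s + n) choose ?s))"
  have geometric: "(\<Sum>t<r. fps_X ^ t) * (1 - fps_X) = (1 - fps_X ^ r :: int fps)"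
    by (simp add: one_diff_power_eq mult.commute)
  \<comment> \<open>Instead of dividing by \<open>1 - fps_X\<close>, the all-ones series is expanded
    so that each geometric sum can absorb one factor \<open>1 - fps_X\<close>.\<close>
  have "(\<Sum>t<r. fps_X ^ t) ^ ?s * Abs_fps (\<lambda>_. 1) = (\<Sum>t<r. fps_X ^ t) ^ ?s * ((1 - fps_X) ^ ?s * ?B)"
    by (simp add: one_minus_fps_X_power_mult_binomial_series)
  also have "\<dots> = (- (fps_X ^ r) + 1) ^ ?s * ?B"
    by (simp add: mult.assoc[symmetric] power_mult_distrib[symmetric] geometric)
  also have "\<dots> = (\<Sum>j\<le>?s. fps_const ((- 1) ^ j * int (?s choose j)) * (fps_X ^ (j * r) * ?B))"
    unfolding binomial_ring sum_distrib_right
    by (intro sum.cong refl)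
      (simp add: power_minus[of "fps_X ^ r"] power_mult[symmetric] mult_ac fps_of_nat[symmetric]
        fps_const_mult[symmetric] fps_const_power[symmetric] fps_const_neg[symmetric]
        del: fps_const_mult fps_const_power fps_const_neg)
  finally have "int (card (reduced_exponents r d :: ('n \<Rightarrow> nat) set)) =
      fps_nth (\<Sum>j\<le>?s. fps_const ((- 1) ^ j * int (?s choose j)) * (fps_X ^ (j * r) * ?B)) d"
    unfolding reduced_exponents_generating_function by (metis fps_nth_Abs_fps)
  \<comment> \<open>The shift by \<open>j * r\<close> reaches the coefficient at \<open>d\<close>
    only if \<open>j * r \<le> d\<close>, so the natural subtraction in the surviving terms is never
    truncated.\<close>
  also have "\<dots> = (\<Sum>j\<le>?s. if j \<le> d div r
      then (- 1) ^ j * int (?s choose j) * int ((?s + d - j * r) choose ?s) else 0)"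
    unfolding fps_sum_nth fps_mult_left_const_nth fps_X_power_mult_nth
    using assms by (intro sum.cong refl) (auto simp: less_eq_div_iff_mult_less_eq not_less)
  also have "\<dots> = (\<Sum>j\<in>{..?s} \<inter> {..d div r}.
      (- 1) ^ j * int (?s choose j) * int ((?s + d - j * r) choose ?s))"
    by (rule sum.mono_neutral_cong_right) auto
  \<comment> \<open>Terms with \<open>j > ?s\<close> may be added freely because
    \<open>?s choose j\<close> is then 0.\<close>
  also have "\<dots> = (\<Sum>j = 0..d div r. (- 1) ^ j * int (?s choose j) * int ((?s + d - j * r) choose ?s))"
    by (rule sum.mono_neutral_left) (auto simp: not_le binomial_eq_0)
  finally show ?thesis .
qed

theorem corollary2p9:
  fixes P :: "'m::finite \<Rightarrow> 'a::{field,finite} ^ 'n::finite"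
    and q s d :: nat
  assumes "CARD('a) = q"
    and "CARD('n) = s"
    and "bij_betw P UNIV (affine_torus :: ('a ^ 'n) set)"
  shows "code_length (evaluation_code P d) = (q - 1) ^ s
    \<and> int (vec.dim (evaluation_code P d)) =
      (\<Sum>j = 0..d div (q - 1). (- 1) ^ j * int (s choose j) * int ((s + d - j * (q - 1)) choose s))"
proof
  show "code_length (evaluation_code P d) = (q - 1) ^ s"
    using bij_betw_same_card[OF assms(3)] assms(1,2) by (simp add: code_length_def card_affine_torus)
next
  have "CARD('a) - 1 > 0"
    using card_field_gt_1[where 'a='a] by simp
  from card_reduced_exponents[where 'n='n, OF this, of d]
  show "int (vec.dim (evaluation_code P d)) =
      (\<Sum>j = 0..d div (q - 1). (- 1) ^ j * int (s choose j) * int ((s + d - j * (q - 1)) choose s))"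
    using assms by (simp add: dim_evaluation_code)
qed

end
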